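(* Let $p,r$ be natural numbers with $0<r<p$ and $\gcd(r,p)=1$. For integers $k,l$ let $Q_{r,p}(k,l)=\frac{p(k^2-l^2)}{2}+\frac{p(k+l)}{2}-lr$. Then for every natural number $n\ge 1$, $$\frac{1}{p}\sum_{\substack{d\ge 1,\ d\mid pn-r^2\\ d\equiv r\pmod p}}\left(d+\frac{pn-r^2}{d}\right)=\sum_{\substack{k_1,l_1,k_2,l_2\in\mathbb{Z}\\ k_1\ge|l_1|,\ k_2\ge|l_2|\\ n=Q_{r,p}(k_1,l_1)+Q_{r,p}(k_2,l_2)+r}}(-1)^{k_1+l_1+k_2+l_2}.$$
   Context: The left-hand sum is over the positive divisors $d$ of the (nonzero) integer $pn-r^2$ that are congruent to $r$ modulo $p$; equivalently, over factorizations $\delta d=pn-r^2$ with $d>0$, $d\equiv r\pmod p$, the summand being $d+\delta$. *)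

theory Defs
  imports Complex_Main "HOL-Number_Theory.Cong"
begin

text \<open>
  The form is taken with real values, so that both divisions by 2 are genuine ones;
  for integer arguments its values are in fact integers.
\<close>

definition Q :: "nat \<Rightarrow> nat \<Rightarrow> int \<Rightarrow> int \<Rightarrow> real" where
  "Q r p k l =
     real p * ((of_int k)\<^sup>2 - (of_int l)\<^sup>2) / 2
     + real p * (of_int k + of_int l) / 2 - of_int l * real r"

text \<open>
  The divisors are taken in the integers, since \<open>p n - r\<^sup>2\<close> may be negative.
\<close>

definition divisors_cong :: "nat \<Rightarrow> nat \<Rightarrow> nat \<Rightarrow> int set" where
  "divisors_cong r p n =
     {d. d \<ge> 1 \<and> d dvd int p * int n - (int r)\<^sup>2 \<and> [d = int r] (mod int p)}"

definition cone_solutions :: "nat \<Rightarrow> nat \<Rightarrow> nat \<Rightarrow> (int \<times> int \<times> int \<times> int) set" where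
  "cone_solutions r p n =
     {(k1, l1, k2, l2). k1 \<ge> \<bar>l1\<bar> \<and> k2 \<ge> \<bar>l2\<bar> \<and> real n = Q r p k1 l1 + Q r p k2 l2 + real r}"

text \<open>
  Both index sets are finite, so that finite sums over them have their intended meaning
  (a sum over an infinite set would be 0 by convention).
\<close>

lemma Q_ge:
  assumes "0 < r" "r < p" "k \<ge> \<bar>l\<bar>"
  shows "Q r p k l \<ge> of_int k"
proof -
  define a b :: real where "a = of_int (k - l)" and "b = of_int (k + l)"
  have ab: "a \<ge> 0" "b \<ge> 0"
    using assms(3) unfolding a_def b_def by linarith+
  have 1: "real r * a \<ge> 1 * a" "(real p - real r) * b \<ge> 1 * b" "real p * (a * b) \<ge> 0"
    using assms ab by (intro mult_right_mono mult_nonneg_nonneg; simp)+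
  have "Q r p k l = (real p * (a * b) + (real p - real r) * b + real r * a) / 2"
    unfolding Q_def a_def b_def by (simp add: field_simps power2_eq_square)
  moreover have "of_int k = (a + b) / 2"
    unfolding a_def b_def by simp
  ultimately show ?thesis
    using 1 by simp
qed

lemma finite_cone_solutions:
  assumes "0 < r" "r < p"
  shows "finite (cone_solutions r p n)"
proof (rule finite_subset)
  let ?I = "{- int n..int n}"
  show "cone_solutions r p n \<subseteq> ?I \<times> ?I \<times> ?I \<times> ?I"
  proof
    fix x assume "x \<in> cone_solutions r p n"
    then obtain k1 l1 k2 l2 where x: "x = (k1, l1, k2, l2)"
      and k: "k1 \<ge> \<bar>l1\<bar>" "k2 \<ge> \<bar>l2\<bar>"
      and n: "real n = Q r p k1 l1 + Q r p k2 l2 + real r"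
      by (auto simp: cone_solutions_def)
    have "of_int (k1 + k2) \<le> real n"
      using Q_ge[OF assms k(1)] Q_ge[OF assms k(2)] n by simp
    then have "k1 + k2 \<le> int n"
      by linarith
    then show "x \<in> ?I \<times> ?I \<times> ?I \<times> ?I"
      using k by (auto simp: x)
  qed
qed simp

lemma finite_divisors_cong:
  assumes "0 < r" "r < p" "coprime r p"
  shows "finite (divisors_cong r p n)"
proof -
  have "int p * int n - (int r)\<^sup>2 \<noteq> 0"
  proof
    assume "int p * int n - (int r)\<^sup>2 = 0"
    then have "int (p * n) = int (r\<^sup>2)"
      by simp
    then have "p dvd r\<^sup>2"
      by (metis dvd_triv_left of_nat_eq_iff)
    moreover have "coprime p (r\<^sup>2)"
      using assms(3) by (simp add: coprime_commute)
    ultimately have "p = 1"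
      by (metis coprime_absorb_left nat_dvd_1_iff_1)
    then show False
      using assms by simp
  qed
  then show ?thesis
    using finite_divisors_int unfolding divisors_cong_def
    by (rule_tac finite_subset[of _ "{d. d dvd int p * int n - (int r)\<^sup>2}"]) auto
qed

end

theory Submission
  imports Defs
begin

text \<open>
  Collect the solutions on the right by \<open>L = l\<^sub>1 + l\<^sub>2\<close>. For fixed \<open>L\<close> the equation becomes
  \<open>2 k\<^sub>1 (k\<^sub>1 + 1) + 2 k\<^sub>2 (k\<^sub>2 + 1) + 1 - (l\<^sub>1 - l\<^sub>2)\<^sup>2 = C\<close> with
  \<open>p C = 4 (n - r + L r) + p (L - 1)\<^sup>2\<close>, and this no longer involves \<open>p\<close> and \<open>r\<close>. The shift
  \<open>l\<^sub>i \<mapsto> l\<^sub>i + 1\<close> compares the signed counts for \<open>L\<close> and \<open>L + 2\<close> up to points on the faces of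
  the cone. With \<open>c = L + 1\<close> the face points are the solutions of \<open>2 e f = C - c\<^sup>2\<close>, \<open>e \<not>\<equiv> f\<close> mod 2,
  in a region symmetric in \<open>e\<close> and \<open>f\<close>, with sign \<open>(-1)\<^sup>e\<close>; swapping \<open>e\<close> and \<open>f\<close> cancels all of
  them except \<open>e = 0\<close>, which occurs only if \<open>C = c\<^sup>2\<close> and then contributes \<open>c\<close>. As the count
  vanishes for large \<open>L\<close>, it equals the root \<open>R > \<bar>L\<bar>\<close> of \<open>R\<^sup>2 = C\<close>, if it exists and has parity
  opposite to \<open>L\<close>. Such pairs \<open>(L, R)\<close> correspond to the factorizations
  \<open>p n - r\<^sup>2 = d \<delta>\<close> with positive factors and \<open>d \<equiv> r\<close> mod \<open>p\<close> via \<open>p R = d + \<delta>\<close> and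
  \<open>p (L - 1) + 2 r = d - \<delta>\<close>. If \<open>p n < r\<^sup>2\<close> there are none, and the divisor sum is 0 by the
  involution \<open>d \<mapsto> -\<delta>\<close>.
\<close>

section \<open>Signed counts of cone points with fixed \<open>l1 + l2\<close>\<close>

definition parity_sign :: "int \<Rightarrow> int" where
  "parity_sign x = (if even x then 1 else - 1)"

definition slice :: "int \<Rightarrow> int \<Rightarrow> (int \<times> int \<times> int \<times> int) set" where
  "slice L C = {(k1, l1, k2, l2). \<bar>l1\<bar> \<le> k1 \<and> \<bar>l2\<bar> \<le> k2 \<and> l1 + l2 = L \<and>
     2 * k1 * (k1 + 1) + 2 * k2 * (k2 + 1) + 1 - (l1 - l2)\<^sup>2 = C}"

definition sign4 :: "int \<times> int \<times> int \<times> int \<Rightarrow> int" where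
  "sign4 = (\<lambda>(k1, l1, k2, l2). parity_sign (k1 + l1 + k2 + l2))"

definition slice_sum :: "int \<Rightarrow> int \<Rightarrow> int" where
  "slice_sum L C = sum sign4 (slice L C)"

text \<open>These are the points of the slice that leave the cone under the shift of both
  \<open>l1\<close> and \<open>l2\<close> by 1.\<close>

definition face :: "int \<Rightarrow> int \<Rightarrow> (int \<times> int \<times> int \<times> int) set" where
  "face L C = {(k1, l1, k2, l2) \<in> slice L C. l1 = k1 \<or> l2 = k2}"

text \<open>On the face \<open>l1 = k1\<close> the bound on \<open>f - e\<close> says
  \<open>0 \<le> k1\<close>, and \<open>1 \<le> e\<close> removes the edge \<open>l2 = k2\<close>.
  The sign of \<open>c\<close> enters only through that bound.\<close>

definition hyperbola :: "int \<Rightarrow> int \<Rightarrow> (int \<times> int) set" where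
  "hyperbola c C = {(e, f). 1 \<le> e \<and> 1 \<le> f \<and> odd (e - f) \<and> f - e \<le> 2 * c - 1 \<and>
     2 * e * f = C - c\<^sup>2}"

lemma sign4_minus:
  assumes "m1 + m2 = - (l1 + l2)"
  shows "sign4 (k1, m1, k2, m2) = sign4 (k1, l1, k2, l2)"
  using assms unfolding sign4_def parity_sign_def prod.case by presburger

lemma sign4_shift: "sign4 (k1, l1 + 1, k2, l2 + 1) = sign4 (k1, l1, k2, l2)"
  unfolding sign4_def parity_sign_def prod.case by presburger

text \<open>Substitute \<open>2 * l1\<^sup>2 + 2 * l2\<^sup>2 - L\<^sup>2\<close> for
  \<open>(l1 - l2)\<^sup>2\<close> and use that each \<open>l\<close> is at most its
  \<open>k\<close> in absolute value. This yields both finiteness and emptiness of the slice for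
  large \<open>L\<close>.\<close>

lemma slice_bound:
  assumes "(k1, l1, k2, l2) \<in> slice L C"
  shows "2 * k1 + 2 * k2 + 1 + L\<^sup>2 \<le> C"
proof -
  have "l1\<^sup>2 \<le> k1\<^sup>2" "l2\<^sup>2 \<le> k2\<^sup>2"
    using assms by (auto simp: slice_def abs_le_square_iff[symmetric])
  then show ?thesis
    using assms by (auto simp: slice_def algebra_simps power2_eq_square)
qed

lemma finite_slice: "finite (slice L C)"
proof (rule finite_subset)
  let ?I = "{- \<bar>C\<bar>..\<bar>C\<bar>}"
  show "slice L C \<subseteq> ?I \<times> ?I \<times> ?I \<times> ?I"
  proof
    fix x assume x: "x \<in> slice L C"
    obtain k1 l1 k2 l2 where eq: "x = (k1, l1, k2, l2)"
      by (cases x)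
    have "2 * k1 + 2 * k2 + 1 + L\<^sup>2 \<le> C" "\<bar>l1\<bar> \<le> k1" "\<bar>l2\<bar> \<le> k2"
      using slice_bound x unfolding eq by (auto simp: slice_def)
    moreover have "0 \<le> L\<^sup>2"
      by simp
    ultimately have "k1 \<le> \<bar>C\<bar>" "k2 \<le> \<bar>C\<bar>"
      by linarith+
    then show "x \<in> ?I \<times> ?I \<times> ?I \<times> ?I"
      using \<open>\<bar>l1\<bar> \<le> k1\<close> \<open>\<bar>l2\<bar> \<le> k2\<close> by (auto simp: eq)
  qed
qed simp

lemma slice_sum_eq_0:
  assumes "C < (\<bar>L\<bar> + 1)\<^sup>2"
  shows "slice_sum L C = 0"
proof -
  have "slice L C = {}"
  proof (rule equals0I)
    fix x assume x: "x \<in> slice L C"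
    obtain k1 l1 k2 l2 where eq: "x = (k1, l1, k2, l2)"
      by (cases x)
    have "2 * k1 + 2 * k2 + 1 + L\<^sup>2 \<le> C" "\<bar>L\<bar> \<le> k1 + k2"
      using slice_bound x unfolding eq by (auto simp: slice_def)
    moreover have "(\<bar>L\<bar> + 1)\<^sup>2 = L\<^sup>2 + 2 * \<bar>L\<bar> + 1"
      by (simp add: power2_eq_square algebra_simps)
    ultimately show False
      using assms by linarith
  qed
  then show ?thesis
    by (simp add: slice_sum_def)
qed

lemma slice_sum_minus: "slice_sum (- L) C = slice_sum L C"
  unfolding slice_sum_def
  by (rule sum.reindex_bij_witness[where i = "\<lambda>(k1, l1, k2, l2). (k1, - l1, k2, - l2)"
        and j = "\<lambda>(k1, l1, k2, l2). (k1, - l1, k2, - l2)"])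
    (auto simp: slice_def power2_eq_square algebra_simps intro!: sign4_minus)

section \<open>Comparison of the slices \<open>L\<close> and \<open>L + 2\<close>\<close>

text \<open>The shift matches the slice \<open>L\<close> off its face with the slice
  \<open>L + 2\<close> off \<open>opposite\<close>, the points that the shift does not reach.
  Negating \<open>l1\<close> and \<open>l2\<close> turns \<open>opposite\<close> into a face for
  \<open>- L - 2\<close>.\<close>

lemma slice_sum_step:
  "slice_sum L C - slice_sum (L + 2) C = sum sign4 (face L C) - sum sign4 (face (- L - 2) C)"
proof -
  define opposite where
    "opposite = {(k1, l1, k2, l2) \<in> slice (L + 2) C. l1 = - k1 \<or> l2 = - k2}"
  have split: "sum sign4 (slice M C) = sum sign4 (slice M C - F) + sum sign4 F"
    if "F \<subseteq> slice M C" for F M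
    using that finite_slice by (rule sum.subset_diff)
  have "sum sign4 (slice L C - face L C) = sum sign4 (slice (L + 2) C - opposite)"
    by (rule sum.reindex_bij_witness[where i = "\<lambda>(k1, l1, k2, l2). (k1, l1 - 1, k2, l2 - 1)"
          and j = "\<lambda>(k1, l1, k2, l2). (k1, l1 + 1, k2, l2 + 1)"])
      (auto simp: slice_def face_def opposite_def sign4_shift)
  moreover have "sum sign4 opposite = sum sign4 (face (- L - 2) C)"
    by (rule sum.reindex_bij_witness[where i = "\<lambda>(k1, l1, k2, l2). (k1, - l1, k2, - l2)"
        and j = "\<lambda>(k1, l1, k2, l2). (k1, - l1, k2, - l2)"])
      (auto simp: slice_def face_def opposite_def power2_eq_square algebra_simps
        intro!: sign4_minus)
  moreover have "face L C \<subseteq> slice L C" "opposite \<subseteq> slice (L + 2) C"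
    by (auto simp: face_def opposite_def)
  ultimately show ?thesis
    using split[of "face L C" L] split[of opposite "L + 2"] by (simp add: slice_sum_def)
qed

text \<open>
  The coordinates are \<open>e = k\<^sub>2 - l\<^sub>2\<close> and \<open>f = l\<^sub>2 + k\<^sub>2 + 1\<close> on the face \<open>l\<^sub>1 = k\<^sub>1\<close>; the last summand
  counts the edge where both faces meet.
\<close>

lemma sum_face:
  "sum sign4 (face (c - 1) C)
    = 2 * (\<Sum>(e, f)\<in>hyperbola c C. parity_sign e) + (if C = c\<^sup>2 then max 0 c else 0)"
proof -
  let ?F = "face (c - 1) C"
  define A where "A = {(k1, l1, k2, l2) \<in> ?F. l1 = k1 \<and> l2 \<noteq> k2}"
  define B where "B = {(k1, l1, k2, l2) \<in> ?F. l1 \<noteq> k1 \<and> l2 = k2}"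
  define E where "E = {(k1, l1, k2, l2) \<in> ?F. l1 = k1 \<and> l2 = k2}"
  have F: "?F = A \<union> (B \<union> E)" "A \<inter> (B \<union> E) = {}" "B \<inter> E = {}"
    by (auto simp: A_def B_def E_def face_def)
  have "finite ?F"
    by (rule finite_subset[OF _ finite_slice]) (auto simp: face_def)
  then have "sum sign4 ?F = sum sign4 A + (sum sign4 B + sum sign4 E)"
    using F by (simp add: sum.union_disjoint)
  \<comment> \<open>Exchanging the two index pairs swaps the faces, whence the factor 2.\<close>
  moreover have "sum sign4 B = sum sign4 A"
    by (rule sum.reindex_bij_witness[where i = "\<lambda>(k1, l1, k2, l2). (k2, l2, k1, l1)"
        and j = "\<lambda>(k1, l1, k2, l2). (k2, l2, k1, l1)"])
      (auto simp: slice_def face_def A_def B_def sign4_def parity_sign_def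
        power2_eq_square algebra_simps)
  moreover have "sum sign4 A = (\<Sum>(e, f)\<in>hyperbola c C. parity_sign e)"
  proof (rule sum.reindex_bij_witness[where
        i = "\<lambda>(e, f). let k1 = (e - f + 1) div 2 + c - 1
                      in (k1, k1, (e + f - 1) div 2, c - 1 - k1)"
        and j = "\<lambda>(k1, l1, k2, l2). (k1 + k2 - c + 1, k2 - k1 + c)"])
    fix x assume x: "x \<in> A"
    obtain k1 l1 k2 l2 where eq: "x = (k1, l1, k2, l2)"
      by (cases x)
    have k: "l1 = k1" "l2 = c - 1 - k1" "l2 \<noteq> k2" "0 \<le> k1" "\<bar>l2\<bar> \<le> k2"
      "2 * k1 * (k1 + 1) + 2 * k2 * (k2 + 1) + 1 - (l1 - l2)\<^sup>2 = C"
      using x by (auto simp: eq A_def face_def slice_def)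
    show "(case case x of (k1, l1, k2, l2) \<Rightarrow> (k1 + k2 - c + 1, k2 - k1 + c) of
            (e, f) \<Rightarrow> let k1 = (e - f + 1) div 2 + c - 1
                      in (k1, k1, (e + f - 1) div 2, c - 1 - k1)) = x"
      using k by (simp add: eq Let_def)
    have "2 * (k1 + k2 - c + 1) * (k2 - k1 + c) = C - c\<^sup>2"
      unfolding k(6)[symmetric] k(1,2) by (simp add: power2_eq_square algebra_simps)
    then show "(case x of (k1, l1, k2, l2) \<Rightarrow> (k1 + k2 - c + 1, k2 - k1 + c)) \<in> hyperbola c C"
      using k by (auto simp: eq hyperbola_def)
    show "(case case x of (k1, l1, k2, l2) \<Rightarrow> (k1 + k2 - c + 1, k2 - k1 + c) of
            (e, f) \<Rightarrow> parity_sign e) = sign4 x"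
      \<comment> \<open>Modulo 2, \<open>k1 + l1 + k2 + l2\<close> is
        \<open>k1 + k2 + c - 1\<close>, which has the parity of \<open>e\<close>.\<close>
      unfolding eq k(1,2) sign4_def parity_sign_def prod.case by presburger
  next
    fix y assume y: "y \<in> hyperbola c C"
    obtain e f where eq: "y = (e, f)"
      by (cases y)
    have ef: "1 \<le> e" "1 \<le> f" "f - e \<le> 2 * c - 1" "2 * e * f = C - c\<^sup>2" "odd (e - f)"
      using y by (auto simp: eq hyperbola_def)
    \<comment> \<open>Odd \<open>e - f\<close> makes both divisions by 2 exact.\<close>
    obtain m where m: "e - f = 2 * m + 1"
      using ef(5) by (rule oddE)
    have e: "e = f + 2 * m + 1"
      using m by simp
    have d: "(e - f + 1) div 2 = m + 1" "(e + f - 1) div 2 = f + m"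
      unfolding e by simp_all
    show "(case case y of (e, f) \<Rightarrow> let k1 = (e - f + 1) div 2 + c - 1
                      in (k1, k1, (e + f - 1) div 2, c - 1 - k1) of
             (k1, l1, k2, l2) \<Rightarrow> (k1 + k2 - c + 1, k2 - k1 + c)) = y"
      unfolding eq prod.case d Let_def by (simp add: e)
    have "C = 2 * (m + c) * (m + c + 1) + 2 * (f + m) * (f + m + 1) + 1
        - (m + c - (c - 1 - (m + c)))\<^sup>2"
      using ef(4) unfolding e by (simp add: power2_eq_square algebra_simps)
    then show "(case y of (e, f) \<Rightarrow> let k1 = (e - f + 1) div 2 + c - 1
                      in (k1, k1, (e + f - 1) div 2, c - 1 - k1)) \<in> A"
      using ef(1-3) unfolding eq prod.case d Let_def
      by (auto simp: A_def face_def slice_def e)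
  qed
  moreover have "sum sign4 E = (if C = c\<^sup>2 then max 0 c else 0)"
  proof -
    have "sum sign4 E = (\<Sum>x\<in>E. 1)"
      by (rule sum.cong) (auto simp: E_def sign4_def parity_sign_def)
    \<comment> \<open>On the edge the equation reads
      \<open>C = (k1 + k2 + 1)\<^sup>2 = c\<^sup>2\<close>, so only \<open>k1\<close> remains free.
      For \<open>c \<le> 0\<close> the range is empty, hence \<open>max 0 c\<close>.\<close>
    also have "\<dots> = (\<Sum>k\<in>(if C = c\<^sup>2 then {0..c - 1} else {}). 1)"
      by (rule sum.reindex_bij_witness[where i = "\<lambda>k. (k, k, c - 1 - k, c - 1 - k)"
          and j = "\<lambda>(k1, l1, k2, l2). k1"])
        (auto simp: E_def face_def slice_def power2_eq_square algebra_simps split: if_splits)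
    also have "\<dots> = (if C = c\<^sup>2 then max 0 c else 0)"
      by auto
    finally show ?thesis .
  qed
  ultimately show ?thesis
    by simp
qed

lemma finite_hyperbola: "finite (hyperbola c C)"
proof (rule finite_subset)
  let ?I = "{- \<bar>C - c\<^sup>2\<bar>..\<bar>C - c\<^sup>2\<bar>}"
  show "hyperbola c C \<subseteq> ?I \<times> ?I"
  proof
    fix y assume y: "y \<in> hyperbola c C"
    obtain e f where eq: "y = (e, f)"
      by (cases y)
    have ef: "1 \<le> e" "1 \<le> f" "2 * e * f = C - c\<^sup>2"
      using y by (auto simp: eq hyperbola_def)
    have "e * 1 \<le> e * f" "1 * f \<le> e * f"
      using ef by (intro mult_left_mono mult_right_mono; simp)+
    then have "e \<le> \<bar>C - c\<^sup>2\<bar>" "f \<le> \<bar>C - c\<^sup>2\<bar>"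
      using ef by linarith+
    then show "y \<in> ?I \<times> ?I"
      using ef by (auto simp: eq)
  qed
qed simp

text \<open>The two sets share their equation and are nested. Their difference is stable under
  swapping \<open>e\<close> and \<open>f\<close>, which reverses the sign because
  \<open>e - f\<close> is odd.\<close>

lemma sum_hyperbola_minus:
  assumes "0 \<le> c"
  shows "(\<Sum>(e, f)\<in>hyperbola (- c) C. parity_sign e)
    = (\<Sum>(e, f)\<in>hyperbola c C. parity_sign e)"
proof -
  let ?s = "\<lambda>(e, f). parity_sign e"
  \<comment> \<open>as \<open>e - f\<close> is odd, this is the region \<open>\<bar>f - e\<bar> \<le> 2 c - 1\<close>\<close>
  define D where "D = hyperbola c C - hyperbola (- c) C"
  have "hyperbola (- c) C \<subseteq> hyperbola c C"
    using assms by (auto simp: hyperbola_def)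
  then have "sum ?s (hyperbola c C) = sum ?s D + sum ?s (hyperbola (- c) C)"
    unfolding D_def using finite_hyperbola by (rule sum.subset_diff)
  moreover have "sum ?s D = (\<Sum>(e, f)\<in>D. - parity_sign e)"
  proof (rule sum.reindex_bij_witness[where i = prod.swap and j = prod.swap])
    have swap: "(f, e) \<in> D" if "(e, f) \<in> D" for e f
    proof -
      have "odd (e - f)" "- 2 * c - 1 < f - e"
        using that by (auto simp: D_def hyperbola_def)
      \<comment> \<open>Parity sharpens the strict bound \<open>e - f < 2 * c + 1\<close> by one
        more unit.\<close>
      then have "e - f \<le> 2 * c - 1"
        by presburger
      then show ?thesis
        using that by (auto simp: D_def hyperbola_def mult_ac)
    qed
    show "prod.swap x \<in> D" if "x \<in> D" for x
      using that swap by (cases x) auto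
    then show "prod.swap x \<in> D" if "x \<in> D" for x
      using that .
    show "(case prod.swap x of (e, f) \<Rightarrow> - parity_sign e) = ?s x" if "x \<in> D" for x
      using that by (cases x) (auto simp: D_def hyperbola_def parity_sign_def)
  qed auto
  then have "sum ?s D = 0"
    by (simp add: case_prod_unfold sum_negf)
  ultimately show ?thesis
    by simp
qed

text \<open>The two faces belong to \<open>c\<close> and \<open>- c\<close>, so the hyperbola sums
  cancel and only the edge of the first survives.\<close>

lemma slice_sum_diff:
  assumes "0 \<le> c"
  shows "slice_sum (c - 1) C = slice_sum (c + 1) C + (if C = c\<^sup>2 then c else 0)"
proof -
  have "- (c - 1) - 2 = - c - 1" "c - 1 + 2 = c + 1"
    by simp_all
  then have "slice_sum (c - 1) C - slice_sum (c + 1) C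
      = sum sign4 (face (c - 1) C) - sum sign4 (face (- c - 1) C)"
    using slice_sum_step[of "c - 1" C] by (simp only:)
  then show ?thesis
    using assms by (auto simp: sum_face sum_hyperbola_minus split: if_splits)
qed

section \<open>Evaluation of the slice sums\<close>

text \<open>There is at most one element, as \<open>R\<close> is positive; summing the set gives the
  root if it exists and 0 otherwise.\<close>

definition roots :: "int \<Rightarrow> int \<Rightarrow> int set" where
  "roots L C = {R. \<bar>L\<bar> < R \<and> odd (R - L) \<and> R\<^sup>2 = C}"

text \<open>Induction from large \<open>L\<close> downwards in steps of 2, starting where the slice
  is empty. Both sides obey the same recursion: passing from \<open>L + 2\<close> to
  \<open>L\<close> adds only the candidate root \<open>L + 1\<close>.\<close>

lemma slice_sum_nonneg:
  assumes "0 \<le> L"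
  shows "slice_sum L C = \<Sum>(roots L C)"
  using assms
proof (induction "nat (C - L)" arbitrary: L rule: less_induct)
  case less
  show ?case
  proof (cases "C < (L + 1)\<^sup>2")
    case True
    have "roots L C = {}"
    proof (rule equals0I)
      fix R assume "R \<in> roots L C"
      then have "(L + 1)\<^sup>2 \<le> R\<^sup>2" "R\<^sup>2 = C"
        using less.prems by (auto simp: roots_def intro!: power_mono)
      then show False
        using True by simp
    qed
    then show ?thesis
      using slice_sum_eq_0[of C L] True less.prems by simp
  next
    case False
    \<comment> \<open>This gives \<open>L < C\<close>, so the truncated measure really
      decreases.\<close>
    have "L + 1 \<le> (L + 1)\<^sup>2"
      using less.prems by (simp add: power2_eq_square)
    then have "nat (C - (L + 2)) < nat (C - L)"
      using False by simp
    then have IH: "slice_sum (L + 2) C = \<Sum>(roots (L + 2) C)"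
      by (rule less.hyps) (use less.prems in simp)
    have roots: "roots L C = (if C = (L + 1)\<^sup>2 then {L + 1} else {}) \<union> roots (L + 2) C"
    proof -
      have "L < R \<and> odd (R - L) \<longleftrightarrow> R = L + 1 \<or> L + 2 < R \<and> odd (R - L)" for R :: int
        by presburger
      moreover have "\<bar>L\<bar> = L" "\<bar>L + 2\<bar> = L + 2" "odd (R - (L + 2)) \<longleftrightarrow> odd (R - L)" for R
        using less.prems by auto
      ultimately have "R \<in> roots L C \<longleftrightarrow> R = L + 1 \<and> C = (L + 1)\<^sup>2 \<or> R \<in> roots (L + 2) C" for R
        unfolding roots_def mem_Collect_eq by metis
      then show ?thesis
        by (intro set_eqI) simp
    qed
    have "finite (roots (L + 2) C)"
    proof (rule finite_subset)
      show "roots (L + 2) C \<subseteq> {0..C}"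
        by (auto simp: roots_def intro!: self_le_power)
    qed simp
    moreover have "L + 1 \<notin> roots (L + 2) C"
      using less.prems by (simp add: roots_def)
    ultimately have "\<Sum>(roots L C) = (if C = (L + 1)\<^sup>2 then L + 1 else 0) + \<Sum>(roots (L + 2) C)"
      unfolding roots by auto
    then show ?thesis
      using slice_sum_diff[of "L + 1" C] less.prems IH by (simp add: add.assoc)
  qed
qed

lemma slice_sum: "slice_sum L C = \<Sum>(roots L C)"
proof (cases "0 \<le> L")
  case False
  have "roots (- L) C = roots L C"
    by (auto simp: roots_def)
  then show ?thesis
    using slice_sum_nonneg[of "- L" C] False by (simp add: slice_sum_minus)
qed (rule slice_sum_nonneg)

section \<open>Reduction of the cone sum to pairs \<open>(L, R)\<close>\<close>

definition square_points :: "nat \<Rightarrow> nat \<Rightarrow> nat \<Rightarrow> (int \<times> int) set" where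
  "square_points r p n = {(L, R). \<bar>L\<bar> < R \<and> odd (R - L) \<and>
     int p * R\<^sup>2 = 4 * (int n - int r + L * int r) + int p * (L - 1)\<^sup>2}"

text \<open>Multiply the equation by 4, write \<open>2 * (l1\<^sup>2 + l2\<^sup>2)\<close> as
  \<open>(l1 + l2)\<^sup>2 + (l1 - l2)\<^sup>2\<close>, and complete the square in
  \<open>l1 + l2\<close>.\<close>

lemma cone_solutions_iff:
  "(k1, l1, k2, l2) \<in> cone_solutions r p n \<longleftrightarrow> \<bar>l1\<bar> \<le> k1 \<and> \<bar>l2\<bar> \<le> k2 \<and>
     int p * (2 * k1 * (k1 + 1) + 2 * k2 * (k2 + 1) + 1 - (l1 - l2)\<^sup>2)
       = 4 * (int n - int r + (l1 + l2) * int r) + int p * (l1 + l2 - 1)\<^sup>2"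
proof -
  have "real n = Q r p k1 l1 + Q r p k2 l2 + real r \<longleftrightarrow>
      real_of_int (int p * (2 * k1 * (k1 + 1) + 2 * k2 * (k2 + 1) + 1 - (l1 - l2)\<^sup>2))
       = real_of_int (4 * (int n - int r + (l1 + l2) * int r) + int p * (l1 + l2 - 1)\<^sup>2)"
    by (simp add: Q_def power2_eq_square field_simps) argo
  then show ?thesis
    unfolding of_int_eq_iff by (auto simp: cone_solutions_def)
qed

text \<open>If \<open>p\<close> divides the right side of the equation, the quotient is the
  \<open>C\<close> of a slice; otherwise both index sets are empty.\<close>

lemma sum_cone_fiber:
  assumes "0 < p"
  shows "sum sign4 {x \<in> cone_solutions r p n. (case x of (k1, l1, k2, l2) \<Rightarrow> l1 + l2) = L}
    = (\<Sum>(L', R)\<in>{y \<in> square_points r p n. fst y = L}. R)" (is "sum _ ?A = ?rhs")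
proof -
  let ?m = "4 * (int n - int r + L * int r) + int p * (L - 1)\<^sup>2"
  have rhs: "?rhs = \<Sum>{R. (L, R) \<in> square_points r p n}"
    by (rule sum.reindex_bij_witness[where i = "Pair L" and j = snd]) auto
  show ?thesis
  proof (cases "int p dvd ?m")
    case True
    then obtain C where C: "?m = int p * C" ..
    have "?A = slice L C"
      using assms C by (auto simp: cone_solutions_iff slice_def)
    moreover have "{R. (L, R) \<in> square_points r p n} = roots L C"
      using assms C by (auto simp: square_points_def roots_def)
    ultimately show ?thesis
      using slice_sum[of L C] rhs by (simp add: slice_sum_def)
  next
    case False
    have "?A = {}"
    proof (rule equals0I)
      fix x assume x: "x \<in> ?A"
      obtain k1 l1 k2 l2 where eq: "x = (k1, l1, k2, l2)"
        by (cases x)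
      show False
        using x False unfolding eq by (auto simp: cone_solutions_iff) (metis dvd_triv_left)
    qed
    moreover have "{R. (L, R) \<in> square_points r p n} = {}"
    proof (rule equals0I)
      fix R assume "R \<in> {R. (L, R) \<in> square_points r p n}"
      then have "?m = int p * R\<^sup>2"
        by (simp add: square_points_def)
      then show False
        using False by simp
    qed
    ultimately show ?thesis
      using rhs by (simp only: sum.empty)
  qed
qed

lemma sum_cone:
  assumes "0 < r" "r < p" "finite (square_points r p n)"
  shows "sum sign4 (cone_solutions r p n) = (\<Sum>(L, R)\<in>square_points r p n. R)"
proof -
  let ?g = "\<lambda>(k1, l1, k2, l2). l1 + l2 :: int"
  \<comment> \<open>One finite set of values of \<open>L\<close> that serves to group both
    sums.\<close>
  let ?T = "?g ` cone_solutions r p n \<union> fst ` square_points r p n"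
  have fin: "finite (cone_solutions r p n)"
    using assms by (simp add: finite_cone_solutions)
  then have T: "finite ?T"
    using assms(3) by simp
  have "sum sign4 (cone_solutions r p n)
      = (\<Sum>L\<in>?T. sum sign4 {x \<in> cone_solutions r p n. ?g x = L})"
    by (rule sum.group[OF fin T, symmetric]) auto
  also have "\<dots> = (\<Sum>L\<in>?T. \<Sum>(L', R)\<in>{y \<in> square_points r p n. fst y = L}. R)"
    using assms by (intro sum.cong refl sum_cone_fiber) simp
  also have "\<dots> = (\<Sum>(L, R)\<in>square_points r p n. R)"
    by (rule sum.group[OF assms(3) T]) auto
  finally show ?thesis .
qed

section \<open>Factorizations of \<open>p * n - r\<^sup>2\<close>\<close>

text \<open>Modulo \<open>p\<close>, \<open>r * e\<close> equals \<open>d * e\<close>, hence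
  \<open>- r\<^sup>2\<close>, and \<open>r\<close> can be cancelled.\<close>

lemma cofactor_cong:
  fixes d e r p n :: int
  assumes "coprime r p" "d * e = p * n - r\<^sup>2" "[d = r] (mod p)"
  shows "[e = - r] (mod p)"
proof -
  have "[r * e = d * e] (mod p)"
    using assms(3) by (intro cong_mult cong_refl) (rule cong_sym)
  moreover have "[p * n - r\<^sup>2 = r * (- r)] (mod p)"
    by (simp add: cong_iff_dvd_diff power2_eq_square)
  ultimately have "[r * e = r * (- r)] (mod p)"
    using assms(2) by (metis cong_trans)
  then show ?thesis
    using assms(1) by (simp only: cong_mult_lcancel)
qed

text \<open>With \<open>R = a + b + 1\<close> and \<open>L = b - a\<close>, the two factors have sum
  \<open>p * R\<close> and difference \<open>p * (L - 1) + 2 * r\<close>; four times their product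
  is the difference of the squares.\<close>

lemma square_point_divisor:
  fixes p r n a b :: int
  assumes "p \<noteq> 0"
  shows "p * (a + b + 1)\<^sup>2 = 4 * (n - r + (b - a) * r) + p * (b - a - 1)\<^sup>2 \<longleftrightarrow>
    (p * b + r) * (p * a + p - r) = p * n - r\<^sup>2"
proof -
  have "p * (p * (a + b + 1)\<^sup>2 - (4 * (n - r + (b - a) * r) + p * (b - a - 1)\<^sup>2))
      = 4 * ((p * b + r) * (p * a + p - r) - (p * n - r\<^sup>2))"
    by (simp add: power2_eq_square algebra_simps)
  then show ?thesis
    using assms by auto
qed

text \<open>Both sides are parametrized by \<open>a, b \<ge> 0\<close>: the point is
  \<open>(b - a, a + b + 1)\<close>, the divisor \<open>p * b + r\<close> and its cofactor
  \<open>p * a + p - r\<close>.\<close>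

lemma sum_positive_divisors:
  fixes p r n :: nat
  assumes "0 < r" "r < p" "coprime r p"
  defines "N \<equiv> int p * int n - (int r)\<^sup>2"
  defines "D \<equiv> {d \<in> divisors_cong r p n. 0 < N div d}"
  shows "bij_betw (\<lambda>(L, R). int p * ((R - 1 + L) div 2) + int r) (square_points r p n) D"
    and "(\<Sum>d\<in>D. d + N div d) = int p * (\<Sum>(L, R)\<in>square_points r p n. R)"
proof -
  let ?f = "\<lambda>(L, R). int p * ((R - 1 + L) div 2) + int r"
  let ?g = "\<lambda>d. ((d - int r) div int p - (N div d + int r - int p) div int p,
                 (d - int r) div int p + (N div d + int r - int p) div int p + 1)"
  have points: "\<exists>a b. x = (b - a, a + b + 1) \<and> 0 \<le> a \<and> 0 \<le> b \<and>
      (int p * b + int r) * (int p * a + int p - int r) = N \<and>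
      N div (int p * b + int r) = int p * a + int p - int r"
    if x: "x \<in> square_points r p n" for x
  proof -
    obtain L R where eq: "x = (L, R)"
      by (cases x)
    have LR: "\<bar>L\<bar> < R" "odd (R - L)"
      "int p * R\<^sup>2 = 4 * (int n - int r + L * int r) + int p * (L - 1)\<^sup>2"
      using x by (auto simp: eq square_points_def)
    obtain a where a: "R - L = 2 * a + 1"
      using LR(2) by (rule oddE)
    define b where "b = a + L"
    have L: "L = b - a" and R: "R = a + b + 1"
      using a by (auto simp: b_def)
    have ab: "0 \<le> a" "0 \<le> b"
      using LR(1) unfolding L R by linarith+
    moreover have prod: "(int p * b + int r) * (int p * a + int p - int r) = N"
      using LR(3) assms(1,2) unfolding L R N_def by (subst (asm) square_point_divisor) auto
    moreover have "int p * b + int r \<noteq> 0"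
      using ab assms(1) by (simp add: add_nonneg_eq_0_iff)
    ultimately have "N div (int p * b + int r) = int p * a + int p - int r"
      by (metis nonzero_mult_div_cancel_left)
    then show ?thesis
      using ab prod eq L R by blast
  qed
  have divisors: "\<exists>a b. d = int p * b + int r \<and> N div d = int p * a + int p - int r \<and>
      0 \<le> a \<and> 0 \<le> b \<and> (int p * b + int r) * (int p * a + int p - int r) = N"
    if d: "d \<in> D" for d
  proof -
    have dvd: "d * (N div d) = N" "0 < d" "0 < N div d" "[d = int r] (mod int p)"
      using d by (auto simp: D_def divisors_cong_def N_def)
    then have "[N div d = - int r] (mod int p)"
      using cofactor_cong[of "int r" "int p" d "N div d" "int n"] assms(3)
      by (simp add: N_def)
    then have "int p dvd N div d - (- int r)"
      by (simp add: cong_iff_dvd_diff)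
    then obtain a' where a': "N div d - (- int r) = int p * a'" ..
    have "int p dvd d - int r"
      using dvd(4) by (simp add: cong_iff_dvd_diff)
    then obtain b where b: "d - int r = int p * b" ..
    \<comment> \<open>Since \<open>r < p\<close>, positivity of \<open>d\<close> already forces
      \<open>b > - 1\<close>.\<close>
    have "0 < int p * (b + 1)"
      using b dvd(2) assms(2) by (simp add: algebra_simps)
    then have "0 \<le> b"
      using assms(2) by (simp add: zero_less_mult_iff)
    moreover have "0 < int p * a'"
      using a' dvd(3) by simp
    then have "0 \<le> a' - 1"
      using assms(2) by (simp add: zero_less_mult_iff)
    moreover have "d = int p * b + int r" "N div d = int p * (a' - 1) + int p - int r"
      using a' b by (simp_all add: algebra_simps)
    ultimately show ?thesis
      using dvd(1) by metis
  qed
  have half: "(a + b + 1 - 1 + (b - a)) div 2 = b" for a b :: int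
    by simp
  have p: "int p \<noteq> 0"
    using assms(2) by simp
  have gf: "?g (?f x) = x" and fD: "?f x \<in> D"
    and sum_eq: "?f x + N div ?f x = int p * (case x of (L, R) \<Rightarrow> R)"
    if x: "x \<in> square_points r p n" for x
  proof -
    obtain a b where ab: "x = (b - a, a + b + 1)" "0 \<le> a" "0 \<le> b"
      "(int p * b + int r) * (int p * a + int p - int r) = N"
      "N div (int p * b + int r) = int p * a + int p - int r"
      using points[OF x] by blast
    have f: "?f x = int p * b + int r"
      unfolding ab(1) prod.case half ..
    show "?g (?f x) = x"
      unfolding f ab(5) using p by (simp add: ab(1))
    have "0 \<le> int p * b" "0 \<le> int p * a"
      using ab by simp_all
    then have "1 \<le> int p * b + int r" "0 < int p * a + int p - int r"
      using assms(1,2) by linarith+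
    then show "?f x \<in> D"
      unfolding f D_def divisors_cong_def using ab(5)
      by (auto simp: N_def[symmetric] ab(4)[symmetric] cong_iff_dvd_diff)
    show "?f x + N div ?f x = int p * (case x of (L, R) \<Rightarrow> R)"
      unfolding f ab(5) by (simp add: ab(1) algebra_simps)
  qed
  have fg: "?f (?g d) = d" and gP: "?g d \<in> square_points r p n" if d: "d \<in> D" for d
  proof -
    obtain a b where ab: "d = int p * b + int r" "N div d = int p * a + int p - int r"
      "0 \<le> a" "0 \<le> b" "(int p * b + int r) * (int p * a + int p - int r) = N"
      using divisors[OF d] by blast
    have g: "?g d = (b - a, a + b + 1)"
      unfolding ab(2) using p by (simp add: ab(1))
    show "?f (?g d) = d"
      unfolding g prod.case half by (simp add: ab(1))
    have "odd (a + b + 1 - (b - a))"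
      by presburger
    moreover have "\<bar>b - a\<bar> < a + b + 1"
      using ab(3,4) by linarith
    moreover have "int p * (a + b + 1)\<^sup>2
        = 4 * (int n - int r + (b - a) * int r) + int p * (b - a - 1)\<^sup>2"
      by (rule iffD2[OF square_point_divisor[OF p] ab(5)[unfolded N_def]])
    ultimately show "?g d \<in> square_points r p n"
      unfolding g square_points_def mem_Collect_eq prod.case by (intro conjI)
  qed
  show "bij_betw ?f (square_points r p n) D"
    using gf fg fD gP by (intro bij_betw_byWitness[where f' = ?g]) auto
  from sum.reindex_bij_betw[OF this, of "\<lambda>d. d + N div d"]
  have "(\<Sum>d\<in>D. d + N div d) = (\<Sum>x\<in>square_points r p n. ?f x + N div ?f x)"
    by simp
  also have "\<dots> = int p * (\<Sum>(L, R)\<in>square_points r p n. R)"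
    unfolding sum_distrib_left by (intro sum.cong refl sum_eq)
  finally show "(\<Sum>d\<in>D. d + N div d) = int p * (\<Sum>(L, R)\<in>square_points r p n. R)" .
qed

text \<open>The map from \<open>d\<close> to minus its cofactor is an involution: it preserves
  positivity and, as the cofactor is \<open>- r\<close> modulo \<open>p\<close>, also the residue
  \<open>r\<close>. It negates the summand.\<close>

lemma sum_nonpositive_divisors:
  fixes p r n :: nat
  assumes "coprime r p"
  defines "N \<equiv> int p * int n - (int r)\<^sup>2"
  assumes "N \<noteq> 0"
  shows "(\<Sum>d | d \<in> divisors_cong r p n \<and> N div d \<le> 0. d + N div d) = 0" (is "sum ?h ?D = 0")
proof -
  let ?i = "\<lambda>d. - (N div d)"
  have D: "d * (N div d) = N" "1 \<le> d" "N div d < 0" "[d = int r] (mod int p)"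
    if "d \<in> ?D" for d
  proof -
    show "d * (N div d) = N" "1 \<le> d" "[d = int r] (mod int p)"
      using that by (auto simp: divisors_cong_def N_def)
    then show "N div d < 0"
      using that assms(3) by (cases "N div d = 0") auto
  qed
  have inv: "N div ?i d = - d" if "d \<in> ?D" for d
  proof -
    have "- d * ?i d = N" "?i d \<noteq> 0"
      using D[OF that] by simp_all
    then show ?thesis
      by (metis nonzero_mult_div_cancel_right)
  qed
  have "sum ?h ?D = (\<Sum>d\<in>?D. - ?h d)"
  proof (rule sum.reindex_bij_witness[where i = ?i and j = ?i])
    show i: "?i d \<in> ?D" if "d \<in> ?D" for d
    proof -
      have "[N div d = - int r] (mod int p)"
        using cofactor_cong[of "int r" "int p" d "N div d" "int n"] assms(1) D[OF that]
        by (simp add: N_def)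
      then have "[?i d = int r] (mod int p)"
        by (metis cong_minus_minus_iff minus_minus)
      moreover have "?i d dvd N"
        using D(1)[OF that] by (metis dvd_triv_right minus_dvd_iff)
      moreover have "1 \<le> ?i d" "- d \<le> 0"
        using D(2,3)[OF that] by linarith+
      ultimately show ?thesis
        unfolding mem_Collect_eq divisors_cong_def N_def[symmetric] inv[OF that] by blast
    qed
    then show "?i d \<in> ?D" if "d \<in> ?D" for d
      using that .
    show "?i (?i d) = d" if "d \<in> ?D" for d
      unfolding inv[OF that] by simp
    then show "?i (?i d) = d" if "d \<in> ?D" for d
      using that .
    show "- ?h (?i d) = ?h d" if "d \<in> ?D" for d
      unfolding inv[OF that] by simp
  qed
  also have "\<dots> = - sum ?h ?D"
    by (rule sum_negf)
  finally show ?thesis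
    by simp
qed

theorem theorem1p2:
  fixes p r n :: nat
  assumes "0 < r" and "r < p" and "gcd r p = 1" and "n \<ge> 1"
  shows "1 / real p *
           (\<Sum>d\<in>divisors_cong r p n.
              real_of_int d + (real p * real n - (real r)\<^sup>2) / real_of_int d)
         = (\<Sum>(k1, l1, k2, l2)\<in>cone_solutions r p n. (- 1) powi (k1 + l1 + k2 + l2))"
proof -
  define N where "N = int p * int n - (int r)\<^sup>2"
  have cop: "coprime r p"
    using assms(3) by (simp add: coprime_iff_gcd_eq_1)
  have fin: "finite (divisors_cong r p n)"
    using assms(1,2) cop by (rule finite_divisors_cong)
  have N: "N \<noteq> 0"
  proof
    \<comment> \<open>Otherwise every positive integer in the residue class of \<open>r\<close>
      would be a divisor, contradicting finiteness.\<close>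
    assume N0: "N = 0"
    have "int ` {k. [k = r] (mod p)} - {0} \<subseteq> divisors_cong r p n"
      using N0 by (auto simp: divisors_cong_def N_def[symmetric] cong_int_iff)
    then have "finite (int ` {k. [k = r] (mod p)})"
      using fin by (metis finite_Diff2 finite.emptyI finite.insertI finite_subset)
    then have "finite {k. [k = r] (mod p)}"
      by (simp add: finite_image_iff)
    moreover have "range (\<lambda>j. r + p * j) \<subseteq> {k. [k = r] (mod p)}"
      by (auto simp: cong_def)
    ultimately have "finite (range (\<lambda>j. r + p * j))"
      by (rule finite_subset[rotated])
    then show False
      using assms(2) by (simp add: finite_image_iff inj_on_def)
  qed
  \<comment> \<open>Splitting by the sign of the cofactor treats both signs of \<open>N\<close> at
    once.\<close>
  let ?D = "{d \<in> divisors_cong r p n. 0 < N div d}"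
  let ?E = "{d \<in> divisors_cong r p n. N div d \<le> 0}"
  have "divisors_cong r p n = ?D \<union> ?E" "?D \<inter> ?E = {}"
    by auto
  then have "(\<Sum>d\<in>divisors_cong r p n. d + N div d)
      = (\<Sum>d\<in>?D. d + N div d) + (\<Sum>d\<in>?E. d + N div d)"
    using fin by (subst \<open>divisors_cong r p n = ?D \<union> ?E\<close>) (rule sum.union_disjoint; simp)
  also have "\<dots> = int p * (\<Sum>(L, R)\<in>square_points r p n. R)"
    using sum_positive_divisors(2)[OF assms(1,2) cop] sum_nonpositive_divisors[OF cop] N
    by (simp add: N_def)
  also have "\<dots> = int p * sum sign4 (cone_solutions r p n)"
  proof -
    \<comment> \<open>Finiteness is transported from the divisors by the bijection.\<close>
    have "finite (square_points r p n)"
      using bij_betw_finite[OF sum_positive_divisors(1)[OF assms(1,2) cop]] fin by simp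
    then show ?thesis
      using assms(1,2) by (simp add: sum_cone)
  qed
  finally have *: "(\<Sum>d\<in>divisors_cong r p n. d + N div d)
      = int p * sum sign4 (cone_solutions r p n)" .
  have "(\<Sum>d\<in>divisors_cong r p n.
        real_of_int d + (real p * real n - (real r)\<^sup>2) / real_of_int d)
      = real_of_int (\<Sum>d\<in>divisors_cong r p n. d + N div d)"
    unfolding of_int_sum
  proof (rule sum.cong[OF refl])
    fix d assume "d \<in> divisors_cong r p n"
    then have "real_of_int (N div d) = real_of_int N / real_of_int d"
      by (intro real_of_int_div) (simp add: divisors_cong_def N_def)
    then show "real_of_int d + (real p * real n - (real r)\<^sup>2) / real_of_int d
        = real_of_int (d + N div d)"
      by (simp add: N_def)
  qed
  moreover have "(\<Sum>(k1, l1, k2, l2)\<in>cone_solutions r p n. (- 1) powi (k1 + l1 + k2 + l2))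
      = real_of_int (sum sign4 (cone_solutions r p n))"
    unfolding of_int_sum
    by (rule sum.cong) (auto simp: sign4_def parity_sign_def power_int_minus_left)
  ultimately show ?thesis
    using * assms(2) by simp
qed

end
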